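(* Let $m,k$ be integers such that $k$ divides $m$ and $\gcd(2^m-1,2^k+1)=1$, let $e=2^m-2^k-2$ and $d$ the inverse of $e$ modulo $2^m-1$, and let $\pi(i)=\gamma_i$ be a bijection from $\mathbb{Z}_{2^k}$ to $\mathbb{F}_{2^k}$. Define $f_A,f_B:\mathbb{F}_{2^m}\times\mathbb{F}_{2^m}\to\mathbb{Z}_{2^k}$ by: $f_A(x,y)=i$ if $(x,y)\in\mathcal{A}(\gamma_i)$, and $f_A(0,y)=0$ for all $y\in\mathbb{F}_{2^m}$; $f_B(x,y)=i$ if $(x,y)\in\mathcal{B}(\gamma_i)$, and $f_B(x,0)=0$ for all $x\in\mathbb{F}_{2^m}$. Then $f_A$ and $f_B$ are $\mathbb{Z}_{2^k}$-bent functions.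
   Context: ${\rm Tr}^m_k$ is the relative trace $\mathbb{F}_{2^m}\to\mathbb{F}_{2^k}$, ${\rm Tr}_m$ the absolute trace; powers of nonzero elements have exponents modulo $2^m-1$. For $\gamma\in\mathbb{F}_{2^k}$: $\mathcal{A}(\gamma)=\bigcup_{s\in\mathbb{F}_{2^m}:{\rm Tr}^m_k(s)=\gamma}\{(x,sx^{2^k+1}):x\in\mathbb{F}_{2^m}^*\}$ and $\mathcal{B}(\gamma)=\bigcup_{s\in\mathbb{F}_{2^m}:{\rm Tr}^m_k(s)=\gamma}\{(x^{-d}s,x):x\in\mathbb{F}_{2^m}^*\}$ (the sets $\mathcal{A}(\gamma)$ together with $\{(0,y)\}$ partition $\mathbb{F}_{2^m}^2$, and likewise the $\mathcal{B}(\gamma)$ together with $\{(x,0)\}$). A function $f:\mathbb{F}_{2^m}\times\mathbb{F}_{2^m}\to\mathbb{Z}_{2^k}$ is $\mathbb{Z}_{2^k}$-bent if $\left|\sum_{x,y\in\mathbb{F}_{2^m}}\zeta^{af(x,y)}(-1)^{{\rm Tr}_m(ux+vy)}\right|=2^m$ for all nonzero $a\in\mathbb{Z}_{2^k}$ and all $u,v\in\mathbb{F}_{2^m}$, with $\zeta$ a complex primitive $2^k$-th root of unity. *)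

theory Defs
  imports Complex_Main "HOL-Library.Cardinality" "HOL-Number_Theory.Cong"
begin

text \<open>
  The field of order $2^m$ is a type of class \<open>{field, finite}\<close> with \<open>2 ^ m\<close> elements.
  For \<open>k dvd m\<close> its unique subfield of order $2^k$ is the fixed field of the
  \<open>k\<close>-th power of the Frobenius map, and $Z_{2^k}$ is represented by \<open>{..<2 ^ k}\<close>.
\<close>

definition subfield2 :: "nat \<Rightarrow> 'a::field set" where
  "subfield2 k = {x. x ^ (2 ^ k) = x}"

definition rel_trace :: "nat \<Rightarrow> nat \<Rightarrow> 'a::field \<Rightarrow> 'a" where
  "rel_trace m k x = (\<Sum>i<m div k. x ^ (2 ^ (k * i)))"

abbreviation abs_trace :: "nat \<Rightarrow> 'a::field \<Rightarrow> 'a" where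
  "abs_trace m \<equiv> rel_trace m 1"

text \<open>$(-1)^{Tr_m(z)}$; the absolute trace takes only the values 0 and 1.\<close>

definition trace_sign :: "nat \<Rightarrow> 'a::field \<Rightarrow> complex" where
  "trace_sign m z = (if abs_trace m z = 0 then 1 else -1)"

definition set_A :: "nat \<Rightarrow> nat \<Rightarrow> 'a::field \<Rightarrow> ('a \<times> 'a) set" where
  "set_A m k \<gamma> = (\<Union>s\<in>{s. rel_trace m k s = \<gamma>}. {(x, s * x ^ (2 ^ k + 1)) |x. x \<noteq> 0})"

definition set_B :: "nat \<Rightarrow> nat \<Rightarrow> int \<Rightarrow> 'a::field \<Rightarrow> ('a \<times> 'a) set" where
  "set_B m k d \<gamma> = (\<Union>s\<in>{s. rel_trace m k s = \<gamma>}. {(x powi (- d) * s, x) |x. x \<noteq> 0})"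

definition f_A :: "nat \<Rightarrow> nat \<Rightarrow> (nat \<Rightarrow> 'a::field) \<Rightarrow> 'a \<Rightarrow> 'a \<Rightarrow> nat" where
  "f_A m k \<pi> x y = (if x = 0 then 0 else (THE i. i < 2 ^ k \<and> (x, y) \<in> set_A m k (\<pi> i)))"

definition f_B :: "nat \<Rightarrow> nat \<Rightarrow> int \<Rightarrow> (nat \<Rightarrow> 'a::field) \<Rightarrow> 'a \<Rightarrow> 'a \<Rightarrow> nat" where
  "f_B m k d \<pi> x y = (if y = 0 then 0 else (THE i. i < 2 ^ k \<and> (x, y) \<in> set_B m k d (\<pi> i)))"

definition primitive_root_of_unity :: "nat \<Rightarrow> complex \<Rightarrow> bool" where
  "primitive_root_of_unity n \<zeta> \<longleftrightarrow> \<zeta> ^ n = 1 \<and> (\<forall>j. 0 < j \<and> j < n \<longrightarrow> \<zeta> ^ j \<noteq> 1)"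

definition Z_bent :: "nat \<Rightarrow> nat \<Rightarrow> ('a::{field,finite} \<Rightarrow> 'a \<Rightarrow> nat) \<Rightarrow> bool" where
  "Z_bent m k f \<longleftrightarrow>
     (\<forall>x y. f x y < 2 ^ k) \<and>
     (\<forall>\<zeta>. primitive_root_of_unity (2 ^ k) \<zeta> \<longrightarrow>
       (\<forall>a u v. 0 < a \<and> a < 2 ^ k \<longrightarrow>
         cmod (\<Sum>x\<in>UNIV. \<Sum>y\<in>UNIV. \<zeta> ^ (a * f x y) * trace_sign m (u * x + v * y)) = 2 ^ m))"

end

theory Submission
  imports Defs "HOL-Computational_Algebra.Polynomial"
begin

text \<open>
  Write \<open>K\<close> for the subfield of order $2^k$, \<open>Tr\<close> for the relative trace onto it and \<open>\<chi>\<close>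
  for the additive character given by the absolute trace. Let \<open>g\<close> be the weight
  $\zeta^{a \pi^{-1}(z)}$ on \<open>K\<close>; it has modulus 1 and sum 0. The Fourier transform \<open>W\<close> of
  \<open>g \<circ> Tr\<close> vanishes at 0, and also outside \<open>K\<close>, because \<open>K\<close> and the kernel of \<open>Tr\<close> are
  orthogonal complements; by inversion $\sum_{w \in K} \chi(cw) W(w) = 2^m g(Tr(c))$.

  Since $d$ inverts $-(2^k+1)$ modulo $2^m-1$, both Walsh sums become sums of \<open>W\<close> over
  the nonzero elements of \<open>K\<close>: substitute $w = v x^{2^k+1}$ for \<open>f_A\<close> and $w = u y^{-d}$ for
  \<open>f_B\<close>. On \<open>K\<close> the power $2^k+1$ is squaring, which \<open>\<chi>\<close> absorbs, so the
  inversion formula applies and each Walsh value is $2^m$ times a value of \<open>g\<close>.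
\<close>

section \<open>Preliminaries: powers in finite fields and roots of linearized polynomials\<close>

lemma finite_field_power_card_minus_1:
  fixes x :: "'a::{field,finite}"
  assumes "x \<noteq> 0"
  shows "x ^ (CARD('a) - 1) = 1"
proof -
  have "(\<Prod>y\<in>UNIV-{0}. x * y) = \<Prod>(UNIV - {0::'a})"
    by (rule prod.reindex_bij_witness[of _ "\<lambda>y. y / x" "\<lambda>y. x * y"]) (use assms in auto)
  then have "x ^ (CARD('a) - 1) * \<Prod>(UNIV - {0::'a}) = \<Prod>(UNIV - {0::'a})"
    by (simp add: prod.distrib card_Diff_singleton)
  then show ?thesis
    by simp
qed

text \<open>A nonzero polynomial of degree at most \<open>2 ^ (n - 1)\<close> has too few roots to
  vanish on \<open>S\<close>. With \<open>S\<close> the whole field or \<open>K\<close>, this makes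
  the absolute trace of that field nonzero.\<close>

lemma linearized_sum_nonzero:
  fixes S :: "'a::field set"
  assumes "n > 0" "finite S" "card S \<ge> 2 ^ n"
  shows "\<exists>x\<in>S. (\<Sum>j<n. x ^ (2 ^ j)) \<noteq> 0"
proof (rule ccontr)
  assume contr: "\<not> (\<exists>x\<in>S. (\<Sum>j<n. x ^ (2 ^ j)) \<noteq> 0)"
  define p :: "'a poly" where "p = (\<Sum>j<n. monom 1 (2 ^ j))"
  have "coeff p (2 ^ (n - 1)) = (\<Sum>j<n. if j = n - 1 then 1 else 0)"
    unfolding p_def by (auto simp: coeff_sum intro!: sum.cong)
  also have "\<dots> = 1"
    using assms(1) by simp
  finally have "p \<noteq> 0"
    by auto
  have "degree p \<le> 2 ^ (n - 1)"
    unfolding p_def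
  proof (rule degree_sum_le)
    fix j assume "j \<in> {..<n}"
    then have "(2::nat) ^ j \<le> 2 ^ (n - 1)"
      by (intro power_increasing) auto
    then show "degree (monom (1::'a) (2 ^ j)) \<le> 2 ^ (n - 1)"
      using degree_monom_le le_trans by blast
  qed auto
  moreover have "S \<subseteq> {x. poly p x = 0}"
    using contr by (auto simp: p_def poly_sum poly_monom)
  then have "card S \<le> card {x. poly p x = 0}"
    by (intro card_mono poly_roots_finite \<open>p \<noteq> 0\<close>)
  moreover have "card {x. poly p x = 0} \<le> degree p"
    by (rule card_poly_roots_bound) fact
  moreover have "(2::nat) ^ (n - 1) < 2 ^ n"
    using assms(1) by (intro power_strict_increasing) auto
  ultimately show False
    using assms(3) by linarith
qed

text \<open>The order of \<open>K\<close> is an assumption here; the final theorem obtains it from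
  the bijection \<open>\<pi>\<close>.\<close>

locale binary_field_extension =
  fixes m k :: nat and ty :: "'a::{field,finite} itself"
  assumes m_pos: "m > 0" and k_pos: "k > 0" and k_dvd: "k dvd m"
    and card_UNIV: "CARD('a) = 2 ^ m"
    and card_subfield2: "card (subfield2 k :: 'a set) = 2 ^ k"
begin

abbreviation K :: "'a set" where "K \<equiv> subfield2 k"
abbreviation Tr :: "'a \<Rightarrow> 'a" where "Tr \<equiv> rel_trace m k"
abbreviation tr :: "'a \<Rightarrow> 'a" where "tr \<equiv> abs_trace m"
abbreviation \<chi> :: "'a \<Rightarrow> complex" where "\<chi> \<equiv> trace_sign m"

text \<open>Keeps the index \<open>1\<close> hidden in \<open>tr\<close> from turning into
  \<open>Suc 0\<close>, so that facts about \<open>tr\<close> still match.\<close>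

declare One_nat_def [simp del]

section \<open>Characteristic two and Frobenius powers\<close>

lemma two_eq_0: "(2::'a) = 0"
proof -
  \<comment> \<open>Translation by 1 permutes the field, so \<open>CARD('a)\<close> ones add up to
    0; a vanishing power of 2 forces 2 = 0.\<close>
  have "(\<Sum>x\<in>UNIV. x + 1) = \<Sum>(UNIV :: 'a set)"
    by (rule sum.reindex_bij_witness[of _ "\<lambda>x. x - 1" "\<lambda>x. x + 1"]) auto
  then have "of_nat (CARD('a)) = (0::'a)"
    by (simp add: sum.distrib)
  then show ?thesis
    by (simp add: card_UNIV)
qed

lemma add_self [simp]: "x + x = (0::'a)"
  by (simp add: two_eq_0 flip: mult_2)

lemma add_eq_0_iff_eq: "x + y = 0 \<longleftrightarrow> x = (y::'a)"
  by (metis add_self add_left_cancel)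

lemma add_power_two_power: "((x::'a) + y) ^ (2 ^ n) = x ^ (2 ^ n) + y ^ (2 ^ n)"
proof (induction n)
  case (Suc n)
  have "(x + y) ^ (2 ^ Suc n) = ((x + y) ^ (2 ^ n))\<^sup>2"
    by (simp add: mult.commute flip: power_mult)
  then show ?case
    using Suc by (simp add: power2_sum two_eq_0 flip: power_mult) (simp add: mult.commute)
qed auto

lemma sum_power_two_power: "(\<Sum>i\<in>A. h i :: 'a) ^ (2 ^ n) = (\<Sum>i\<in>A. h i ^ (2 ^ n))"
  by (induction A rule: infinite_finite_induct) (auto simp: add_power_two_power)

lemma power_card: "(x::'a) ^ (2 ^ m) = x"
proof (cases "x = 0")
  case False
  have "x ^ (2 ^ m) = x ^ (CARD('a) - 1) * x"
    by (simp add: card_UNIV flip: power_Suc2)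
  then show ?thesis
    using finite_field_power_card_minus_1[OF False] by simp
qed simp

lemma square_surj: "\<exists>y::'a. y\<^sup>2 = x"
proof
  have "(x ^ (2 ^ (m - 1)))\<^sup>2 = x ^ (2 ^ Suc (m - 1))"
    by (simp add: mult.commute flip: power_mult)
  then show "(x ^ (2 ^ (m - 1)))\<^sup>2 = x"
    using m_pos power_card by simp
qed

lemma power_two_power_surj: "\<exists>y::'a. y ^ (2 ^ n) = x"
proof (induction n arbitrary: x)
  case (Suc n)
  obtain z where z: "z\<^sup>2 = x"
    using square_surj by blast
  obtain y where "y ^ (2 ^ n) = z"
    using Suc by blast
  then have "y ^ (2 ^ Suc n) = x"
    using z by (simp add: power_mult mult.commute[of 2])
  then show ?case ..
qed auto

section \<open>The subfield and the relative trace\<close>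

lemma K_0 [simp]: "0 \<in> K"
  by (simp add: subfield2_def)

lemma K_add [simp]: "x \<in> K \<Longrightarrow> y \<in> K \<Longrightarrow> x + y \<in> K"
  by (simp add: subfield2_def add_power_two_power)

lemma K_divide [simp]: "x \<in> K \<Longrightarrow> y \<in> K \<Longrightarrow> x / y \<in> K"
  by (simp add: subfield2_def power_divide)

lemma K_powi [simp]: "x \<in> K \<Longrightarrow> x powi n \<in> K"
  by (simp add: subfield2_def power_int_def power_inverse) (metis power_commutes power_mult mult.commute)

lemma K_power_iterate: "z \<in> K \<Longrightarrow> z ^ (2 ^ (k * i)) = z"
  by (induction i) (auto simp: subfield2_def power_add power_mult)

lemma K_power_norm: "z \<in> K \<Longrightarrow> z ^ (2 ^ k + 1) = z\<^sup>2"
  by (simp add: subfield2_def power2_eq_square power_add)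

lemma Tr_add: "Tr (x + y) = Tr x + Tr y"
  by (simp add: rel_trace_def add_power_two_power sum.distrib)

lemma Tr_mult: "z \<in> K \<Longrightarrow> Tr (z * x) = z * Tr x"
  by (simp add: rel_trace_def power_mult_distrib K_power_iterate sum_distrib_left)

lemma Tr_Frobenius: "Tr (x ^ (2 ^ k)) = Tr x"
proof -
  define n where "n = m div k"
  have n: "k * n = m"
    using k_dvd by (simp add: n_def)
  \<comment> \<open>Frobenius shifts the summands cyclically. Adding \<open>x\<close> gives one sum
    of \<open>n + 1\<close> terms, which can be split at either end; its last term is
    \<open>x ^ (2 ^ m) = x\<close>.\<close>
  have "Tr (x ^ (2 ^ k)) + x = (\<Sum>i<Suc n. x ^ (2 ^ (k * i)))"
    by (subst sum.lessThan_Suc_shift)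
       (simp add: rel_trace_def n_def power_add flip: power_mult)
  also have "\<dots> = Tr x + x"
    by (simp add: n power_card) (simp add: rel_trace_def n_def)
  finally show ?thesis
    by simp
qed

lemma Tr_in_K [simp]: "Tr x \<in> K"
proof -
  have "Tr x ^ (2 ^ k) = Tr (x ^ (2 ^ k))"
    by (simp add: rel_trace_def sum_power_two_power mult.commute flip: power_mult)
  then show ?thesis
    by (simp add: subfield2_def Tr_Frobenius)
qed

text \<open>Transitivity of the trace: the \<open>m\<close> exponents are cut into blocks of length
  \<open>k\<close>, and summing over the blocks first produces the conjugates of
  \<open>Tr x\<close>.\<close>

lemma abs_trace_tower: "tr x = (\<Sum>j<k. Tr x ^ (2 ^ j))"
proof -
  define n where "n = m div k"
  have n: "n * k = m"
    using k_dvd by (simp add: n_def)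
  have "tr x = (\<Sum>i<n. \<Sum>j=i*k..<i*k+k. x ^ (2 ^ j))"
    by (simp add: rel_trace_def sum.nat_group n)
  also have "\<dots> = (\<Sum>i<n. \<Sum>j<k. x ^ (2 ^ (k * i + j)))"
  proof (rule sum.cong[OF refl])
    fix i
    show "(\<Sum>j=i*k..<i*k+k. x ^ (2 ^ j)) = (\<Sum>j<k. x ^ (2 ^ (k * i + j)))"
      by (rule sum.reindex_bij_witness[of _ "\<lambda>j. j + i * k" "\<lambda>j. j - i * k"])
         (auto simp: mult.commute)
  qed
  also have "\<dots> = (\<Sum>j<k. Tr x ^ (2 ^ j))"
    by (subst sum.swap) (simp add: rel_trace_def n_def sum_power_two_power power_add power_mult)
  finally show ?thesis .
qed

section \<open>The absolute trace and its additive character\<close>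

lemma tr_add: "tr (x + y) = tr x + tr y"
  by (simp add: rel_trace_def add_power_two_power sum.distrib)

lemma tr_square: "tr (x\<^sup>2) = tr x"
proof -
  have "tr (x\<^sup>2) + x = (\<Sum>i<Suc m. x ^ (2 ^ i))"
    by (subst sum.lessThan_Suc_shift) (simp add: rel_trace_def flip: power_mult)
  also have "\<dots> = tr x + x"
    by (simp add: power_card) (simp add: rel_trace_def)
  finally show ?thesis
    by simp
qed

text \<open>The trace is fixed by squaring, hence a root of \<open>T^2 - T\<close>. So the
  \<open>else\<close> branch of \<open>trace_sign\<close> means trace 1, which makes
  \<open>\<chi>\<close> multiplicative.\<close>

lemma tr_cases: "tr x = 0 \<or> tr x = 1"
proof -
  have "(tr x)\<^sup>2 = tr (x\<^sup>2)"
    using sum_power_two_power[of "\<lambda>i. x ^ (2 ^ i)" "{..<m}" 1]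
    by (simp add: rel_trace_def mult.commute flip: power_mult)
  then have "tr x * (tr x - 1) = 0"
    by (simp only: tr_square) (simp add: power2_eq_square algebra_simps)
  then show ?thesis
    by auto
qed

lemma \<chi>_add: "\<chi> (x + y) = \<chi> x * \<chi> y"
  using tr_cases[of x] tr_cases[of y] by (auto simp: trace_sign_def tr_add)

lemma \<chi>_square: "\<chi> (x\<^sup>2) = \<chi> x"
  by (simp add: trace_sign_def tr_square)

lemma \<chi>_0 [simp]: "\<chi> 0 = 1"
  by (simp add: trace_sign_def rel_trace_def power_0_left)

lemma \<chi>_Frobenius: "\<chi> (x ^ (2 ^ n)) = \<chi> x"
proof (induction n)
  case (Suc n)
  have "x ^ (2 ^ Suc n) = (x ^ (2 ^ n))\<^sup>2"
    by (simp add: mult.commute flip: power_mult)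
  then show ?case
    by (simp only: \<chi>_square Suc)
qed simp

lemma tr_nonzero: "\<exists>x. tr x \<noteq> 0"
  using linearized_sum_nonzero[of m "UNIV :: 'a set"] m_pos
  by (auto simp: card_UNIV rel_trace_def)

lemma \<chi>_nondegenerate: "c \<noteq> 0 \<Longrightarrow> \<exists>x. \<chi> (c * x) = -1"
proof -
  assume "c \<noteq> 0"
  obtain x where "tr x \<noteq> 0"
    using tr_nonzero by blast
  then have "\<chi> (c * (x / c)) = -1"
    using \<open>c \<noteq> 0\<close> by (simp add: trace_sign_def)
  then show ?thesis ..
qed

text \<open>By \<open>K\<close>-linearity one element of nonzero relative trace can be scaled to
  reach all of \<open>K\<close>; the tower formula supplies it from a nonzero absolute
  trace.\<close>

lemma Tr_surj: "z \<in> K \<Longrightarrow> \<exists>x. Tr x = z"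
proof -
  assume z: "z \<in> K"
  obtain x where "tr x \<noteq> 0"
    using tr_nonzero by blast
  then have "Tr x \<noteq> 0"
    by (auto simp: abs_trace_tower power_0_left)
  then have "Tr (z / Tr x * x) = z"
    using z by (subst Tr_mult) auto
  then show ?thesis ..
qed

section \<open>Orthogonality relations and fibres of the relative trace\<close>

lemma sum_\<chi>_eq_0:
  assumes "z0 \<in> A" "\<And>z. z \<in> A \<Longrightarrow> z + z0 \<in> A" "\<chi> (z0 * c) = -1"
  shows "(\<Sum>z\<in>A. \<chi> (z * c)) = 0"
proof -
  \<comment> \<open>Translation by \<open>z0\<close> is its own inverse on \<open>A\<close> and
    flips the sign of every term.\<close>
  have "(\<Sum>z\<in>A. \<chi> (z * c)) = (\<Sum>z\<in>A. \<chi> ((z + z0) * c))"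
    by (rule sum.reindex_bij_witness[of _ "\<lambda>z. z + z0" "\<lambda>z. z + z0"])
       (use assms in \<open>auto simp: add.assoc\<close>)
  also have "\<dots> = - (\<Sum>z\<in>A. \<chi> (z * c))"
    using assms(3) by (simp add: distrib_right \<chi>_add sum_negf)
  finally show ?thesis
    by simp
qed

lemma sum_\<chi>_UNIV: "(\<Sum>z\<in>UNIV. \<chi> (c * z)) = (if c = 0 then 2 ^ m else 0)"
proof (cases "c = 0")
  case False
  then obtain x where "\<chi> (c * x) = -1"
    using \<chi>_nondegenerate by blast
  then show ?thesis
    using sum_\<chi>_eq_0[of x UNIV c] False by (simp add: mult.commute)
qed (simp add: card_UNIV)

lemma sum_\<chi>_K: "(\<Sum>z\<in>K. \<chi> (z * c)) = (if Tr c = 0 then 2 ^ k else 0)"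
proof (cases "Tr c = 0")
  case True
  have "\<chi> (z * c) = 1" if "z \<in> K" for z
    using that True by (simp add: trace_sign_def abs_trace_tower Tr_mult power_0_left)
  then show ?thesis
    using True by (simp add: card_subfield2)
next
  case False
  \<comment> \<open>\<open>y\<close> has nonzero trace from \<open>K\<close> to the prime field;
    dividing by \<open>Tr c\<close> makes \<open>y\<close> the relative trace of the argument of
    \<open>\<chi>\<close>.\<close>
  obtain y where y: "y \<in> K" "(\<Sum>j<k. y ^ (2 ^ j)) \<noteq> 0"
    using linearized_sum_nonzero[of k K] k_pos by (auto simp: card_subfield2)
  have "Tr (y / Tr c * c) = y"
    using y False by (subst Tr_mult) auto
  then have "\<chi> (y / Tr c * c) = -1"
    using y by (simp only: trace_sign_def abs_trace_tower) simp
  then show ?thesis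
    using sum_\<chi>_eq_0[of "y / Tr c" K c] y False by simp
qed

lemma card_Tr_fibre: "z \<in> K \<Longrightarrow> card {s. Tr s = z} = card {s. Tr s = 0}"
proof -
  assume "z \<in> K"
  then obtain t where t: "Tr t = z"
    using Tr_surj by blast
  show ?thesis
    by (rule bij_betw_same_card[of "\<lambda>s. s + t"], rule bij_betw_byWitness[of _ "\<lambda>s. s + t"])
       (auto simp: Tr_add t add.assoc)
qed

text \<open>All fibres have the size of the kernel. The general semiring serves both complex sums
  and the counting over \<open>nat\<close> in \<open>card_Tr_kernel\<close>.\<close>

lemma sum_comp_Tr:
  fixes h :: "'a \<Rightarrow> 'b::semiring_1"
  shows "(\<Sum>s\<in>UNIV. h (Tr s)) = of_nat (card {s. Tr s = 0}) * (\<Sum>z\<in>K. h z)"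
proof -
  have "(\<Sum>s\<in>UNIV. h (Tr s)) = (\<Sum>z\<in>K. \<Sum>s | Tr s = z. h (Tr s))"
    by (subst sum.group[of UNIV K Tr "\<lambda>s. h (Tr s)", symmetric]) auto
  also have "\<dots> = (\<Sum>z\<in>K. of_nat (card {s. Tr s = 0}) * h z)"
  proof (rule sum.cong[OF refl])
    fix z assume "z \<in> K"
    have "(\<Sum>s | Tr s = z. h (Tr s)) = (\<Sum>s | Tr s = z. h z)"
      by (rule sum.cong) auto
    then show "(\<Sum>s | Tr s = z. h (Tr s)) = of_nat (card {s. Tr s = 0}) * h z"
      using card_Tr_fibre[OF \<open>z \<in> K\<close>] by simp
  qed
  finally show ?thesis
    by (simp add: sum_distrib_left)
qed

lemma card_Tr_kernel: "2 ^ k * card {s. Tr s = 0} = (2::nat) ^ m"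
  using sum_comp_Tr[of "\<lambda>_. 1::nat"] by (simp add: card_UNIV card_subfield2)

section \<open>The Fourier transform of a function of the relative trace\<close>

definition W :: "('a \<Rightarrow> complex) \<Rightarrow> 'a \<Rightarrow> complex" where
  "W g w = (\<Sum>s\<in>UNIV. g (Tr s) * \<chi> (w * s))"

lemma W_0: "(\<Sum>z\<in>K. g z) = 0 \<Longrightarrow> W g 0 = 0"
  by (simp add: W_def sum_comp_Tr)

lemma W_outside_K:
  assumes "w \<notin> K"
  shows "W g w = 0"
proof -
  \<comment> \<open>The aim is some \<open>t\<close> with \<open>Tr t = 0\<close> and
    \<open>\<chi> (w * t) = -1\<close>: translation by it fixes \<open>Tr\<close> but negates the
    sum. Elements \<open>r + r ^ (2 ^ k)\<close> lie in the kernel, and Frobenius invariance moves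
    the twist from \<open>r\<close> to \<open>w\<close>.\<close>
  have "w ^ (2 ^ k) + w \<noteq> 0"
    using assms by (simp add: add_eq_0_iff_eq subfield2_def)
  then obtain x where x: "\<chi> ((w ^ (2 ^ k) + w) * x) = -1"
    using \<chi>_nondegenerate by blast
  obtain r where r: "r ^ (2 ^ k) = x"
    using power_two_power_surj by blast
  define t where "t = r + x"
  have t: "Tr t = 0"
    using Tr_Frobenius[of r] by (simp add: t_def Tr_add r)
  have "\<chi> (w * r) = \<chi> (w ^ (2 ^ k) * x)"
    using \<chi>_Frobenius[of "w * r" k] by (simp add: power_mult_distrib r)
  then have \<chi>_t: "\<chi> (w * t) = -1"
    using x by (simp add: t_def distrib_left distrib_right \<chi>_add)
  have "W g w = (\<Sum>s\<in>UNIV. g (Tr (s + t)) * \<chi> (w * (s + t)))"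
    unfolding W_def
    by (rule sum.reindex_bij_witness[of _ "\<lambda>z. z + t" "\<lambda>z. z + t"]) (auto simp: add.assoc)
  also have "\<dots> = - W g w"
    by (simp add: W_def Tr_add t distrib_left \<chi>_add \<chi>_t sum_negf)
  finally show ?thesis
    by simp
qed

text \<open>Fourier inversion. Since \<open>W g\<close> vanishes off \<open>K\<close> and at 0,
  \<open>\<phi>\<close> need only agree with a character on the nonzero part of \<open>K\<close>,
  which admits the nonlinear phases arising below.\<close>

lemma sum_\<chi>_W:
  assumes "(\<Sum>z\<in>K. g z) = 0"
    and "\<And>w. w \<in> K \<Longrightarrow> w \<noteq> 0 \<Longrightarrow> \<phi> w = \<chi> (c * w)"
  shows "(\<Sum>w\<in>UNIV-{0}. \<phi> w * W g w) = 2 ^ m * g (Tr c)"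
proof -
  have "(\<Sum>w\<in>UNIV-{0}. \<phi> w * W g w) = (\<Sum>w\<in>K-{0}. \<phi> w * W g w)"
    by (rule sum.mono_neutral_right) (use W_outside_K in auto)
  also have "\<dots> = (\<Sum>w\<in>K-{0}. \<chi> (c * w) * W g w)"
    using assms(2) by (intro sum.cong) auto
  also have "\<dots> = (\<Sum>w\<in>K. \<chi> (c * w) * W g w)"
    by (rule sum.mono_neutral_left) (auto simp: W_0 assms(1))
  \<comment> \<open>After exchanging the sums, orthogonality over \<open>K\<close> retains exactly
    the \<open>s\<close> with \<open>Tr (c + s) = 0\<close>, the fibre of \<open>c\<close>.\<close>
  also have "\<dots> = (\<Sum>s\<in>UNIV. g (Tr s) * (\<Sum>w\<in>K. \<chi> (w * (c + s))))"
    unfolding W_def sum_distrib_left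
    by (subst sum.swap) (simp add: distrib_left \<chi>_add mult_ac)
  also have "\<dots> = (\<Sum>s\<in>UNIV. if Tr s = Tr c then 2 ^ k * g (Tr c) else 0)"
    by (intro sum.cong) (auto simp: sum_\<chi>_K Tr_add add_eq_0_iff_eq)
  also have "\<dots> = of_nat (2 ^ k * card {s. Tr s = Tr c}) * g (Tr c)"
    by (simp add: sum.If_cases)
  also have "\<dots> = 2 ^ m * g (Tr c)"
    by (simp only: card_Tr_fibre[OF Tr_in_K] card_Tr_kernel) simp
  finally show ?thesis .
qed

section \<open>Evaluation of the two Walsh sums\<close>

lemma sum_UNIV_split_0: "(\<Sum>x\<in>UNIV. h x) = h 0 + (\<Sum>x\<in>UNIV-{0::'a}. h x :: complex)"
  by (rule sum.remove) auto

context
  fixes g :: "'a \<Rightarrow> complex" and d :: int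
  assumes sum_g: "(\<Sum>z\<in>K. g z) = 0"
    and norm_g: "\<And>z. cmod (g z) = 1"
    and d_inverse: "[(2 ^ m - 2 ^ k - 2) * d = 1] (mod (2 ^ m - 1))"
begin

lemma powi_norm_exponent:
  assumes "(x::'a) \<noteq> 0"
  shows "x powi ((2 ^ k + 1) * (- d)) = x"
proof -
  \<comment> \<open>Subtracting \<open>(2 ^ m - 1) * d\<close> replaces the factor
    \<open>2 ^ m - 2 ^ k - 2\<close> by \<open>-(2 ^ k + 1)\<close>.\<close>
  have "[(2 ^ m - 2 ^ k - 2) * d - (2 ^ m - 1) * d = 1] (mod (2 ^ m - 1))"
    using cong_diff[OF d_inverse, of "(2 ^ m - 1) * d" 0] by (simp add: cong_0_iff)
  then have "[(2 ^ k + 1) * (- d) = 1] (mod (2 ^ m - 1))"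
    by (simp add: algebra_simps)
  then obtain j where j: "(2 ^ k + 1) * (- d) = 1 + (2 ^ m - 1) * j"
    by (metis cong_iff_lin cong_sym)
  have "x powi (2 ^ m - 1) = x ^ (2 ^ m - 1)"
    using power_int_of_nat[of x "2 ^ m - 1"] by (simp add: of_nat_diff)
  then have "x powi (2 ^ m - 1) = 1"
    using finite_field_power_card_minus_1[OF assms] by (simp add: card_UNIV)
  then show ?thesis
    using assms unfolding j by (simp add: power_int_add power_int_mult)
qed

text \<open>The two power maps are mutually inverse on nonzero elements, which justifies the
  substitutions in both Walsh sums.\<close>

lemma powi_norm_inverse:
  assumes "(x::'a) \<noteq> 0"
  shows "(x ^ (2 ^ k + 1)) powi (- d) = x" and "(x powi (- d)) ^ (2 ^ k + 1) = x"
proof -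
  have *: "y ^ (2 ^ k + 1) = y powi (2 ^ k + 1)" for y :: 'a
    using power_int_of_nat[of y "2 ^ k + 1"] by (simp add: add.commute)
  show "(x ^ (2 ^ k + 1)) powi (- d) = x" "(x powi (- d)) ^ (2 ^ k + 1) = x"
    unfolding * using powi_norm_exponent[OF assms]
    by (simp_all only: mult.commute[of "- d"] flip: power_int_mult)
qed

lemma norm_walsh_A:
  "cmod (\<Sum>x\<in>UNIV. \<Sum>y\<in>UNIV.
     (if x = 0 then 1 else g (Tr (y / x ^ (2 ^ k + 1)))) * \<chi> (u * x + v * y)) = 2 ^ m"
proof -
  \<comment> \<open>For nonzero \<open>v\<close> this is its root of order \<open>2 ^ k + 1\<close>,
    so \<open>v * x ^ (2 ^ k + 1)\<close> becomes a power of \<open>b * x\<close>.\<close>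
  define b where "b = v powi (- d)"
  have inner: "(\<Sum>y\<in>UNIV. g (Tr (y / x ^ (2 ^ k + 1))) * \<chi> (u * x + v * y))
      = \<chi> (u * x) * W g (v * x ^ (2 ^ k + 1))" if "x \<noteq> 0" for x
  proof -
    have "(\<Sum>y\<in>UNIV. g (Tr (y / x ^ (2 ^ k + 1))) * \<chi> (u * x + v * y))
        = (\<Sum>s\<in>UNIV. g (Tr s) * \<chi> (u * x + v * (s * x ^ (2 ^ k + 1))))"
      by (rule sum.reindex_bij_witness[of _ "\<lambda>s. s * x ^ (2 ^ k + 1)" "\<lambda>y. y / x ^ (2 ^ k + 1)"])
         (use that in auto)
    also have "\<dots> = \<chi> (u * x) * W g (v * x ^ (2 ^ k + 1))"
      by (simp add: W_def \<chi>_add sum_distrib_left mult_ac)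
    finally show ?thesis .
  qed
  \<comment> \<open>The line \<open>x = 0\<close> contributes only if \<open>v = 0\<close>; then
    every other term contains \<open>W g 0 = 0\<close>. So exactly one part survives.\<close>
  have eq: "(\<Sum>x\<in>UNIV. \<Sum>y\<in>UNIV.
     (if x = 0 then 1 else g (Tr (y / x ^ (2 ^ k + 1)))) * \<chi> (u * x + v * y))
     = (if v = 0 then 2 ^ m else 0)
       + (\<Sum>x\<in>UNIV-{0}. \<chi> (u * x) * W g (v * x ^ (2 ^ k + 1)))"
    by (subst sum_UNIV_split_0[where h = "\<lambda>x. \<Sum>y\<in>UNIV. _ x y"])
       (simp add: sum_\<chi>_UNIV inner cong: if_cong)
  show ?thesis
  proof (cases "v = 0")
    case True
    then show ?thesis
      unfolding eq by (simp add: W_0 sum_g norm_power)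
  next
    case False
    then have b: "b \<noteq> 0" "b ^ (2 ^ k + 1) = v"
      using powi_norm_inverse(2)[of v] by (simp_all add: b_def)
    have "(\<Sum>x\<in>UNIV-{0}. \<chi> (u * x) * W g (v * x ^ (2 ^ k + 1)))
        = (\<Sum>w\<in>UNIV-{0}. \<chi> (u * (w powi (- d) / b)) * W g w)"
    proof (rule sum.reindex_bij_witness[of _ "\<lambda>w. w powi (- d) / b" "\<lambda>x. (b * x) ^ (2 ^ k + 1)"])
      fix x assume "x \<in> UNIV - {0::'a}"
      then have x: "((b * x) ^ (2 ^ k + 1)) powi (- d) / b = x"
        using powi_norm_inverse(1)[of "b * x"] b(1) by simp
      show "((b * x) ^ (2 ^ k + 1)) powi (- d) / b = x"
        by fact
      show "\<chi> (u * (((b * x) ^ (2 ^ k + 1)) powi (- d) / b)) * W g ((b * x) ^ (2 ^ k + 1))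
          = \<chi> (u * x) * W g (v * x ^ (2 ^ k + 1))"
        by (simp only: x) (simp only: power_mult_distrib b(2))
    qed (use b powi_norm_inverse in auto)
    \<comment> \<open>On \<open>K\<close>, \<open>w\<close> is the square of
      \<open>w powi (- d)\<close>; squaring the argument of \<open>\<chi>\<close> therefore makes it
      linear in \<open>w\<close>, with coefficient \<open>(u / b)\<^sup>2\<close>.\<close>
    also have "\<dots> = 2 ^ m * g (Tr ((u / b)\<^sup>2))"
    proof (rule sum_\<chi>_W[OF sum_g])
      fix w assume w: "w \<in> K" "w \<noteq> 0"
      have "w = (w powi (- d))\<^sup>2"
        using powi_norm_inverse(2)[OF w(2)] K_power_norm K_powi w(1) by metis
      then have "(u * (w powi (- d) / b))\<^sup>2 = (u / b)\<^sup>2 * w"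
        by (simp add: power_mult_distrib power_divide)
      then show "\<chi> (u * (w powi (- d) / b)) = \<chi> ((u / b)\<^sup>2 * w)"
        by (metis \<chi>_square)
    qed
    finally show ?thesis
      unfolding eq using False by (simp add: norm_mult norm_power norm_g)
  qed
qed

lemma norm_walsh_B:
  "cmod (\<Sum>x\<in>UNIV. \<Sum>y\<in>UNIV.
     (if y = 0 then 1 else g (Tr (x / y powi (- d)))) * \<chi> (u * x + v * y)) = 2 ^ m"
proof -
  have inner: "(\<Sum>x\<in>UNIV. g (Tr (x / y powi (- d))) * \<chi> (u * x + v * y))
      = \<chi> (v * y) * W g (u * y powi (- d))" if "y \<noteq> 0" for y
  proof -
    have "(\<Sum>x\<in>UNIV. g (Tr (x / y powi (- d))) * \<chi> (u * x + v * y))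
        = (\<Sum>s\<in>UNIV. g (Tr s) * \<chi> (u * (s * y powi (- d)) + v * y))"
      by (rule sum.reindex_bij_witness[of _ "\<lambda>s. s * y powi (- d)" "\<lambda>x. x / y powi (- d)"])
         (use that in auto)
    also have "\<dots> = \<chi> (v * y) * W g (u * y powi (- d))"
      by (simp add: W_def \<chi>_add sum_distrib_left mult_ac)
    finally show ?thesis .
  qed
  have eq: "(\<Sum>x\<in>UNIV. \<Sum>y\<in>UNIV.
     (if y = 0 then 1 else g (Tr (x / y powi (- d)))) * \<chi> (u * x + v * y))
     = (if u = 0 then 2 ^ m else 0)
       + (\<Sum>y\<in>UNIV-{0}. \<chi> (v * y) * W g (u * y powi (- d)))"
    \<comment> \<open>Here \<open>y\<close> must be the outer variable: the exceptional line is
      \<open>y = 0\<close>, and the inner sum over \<open>x\<close> yields \<open>W\<close>.\<close>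
    by (subst sum.swap, subst sum_UNIV_split_0[where h = "\<lambda>y. \<Sum>x\<in>UNIV. _ x y"])
       (simp add: sum_\<chi>_UNIV inner)
  show ?thesis
  proof (cases "u = 0")
    case True
    then show ?thesis
      unfolding eq by (simp add: W_0 sum_g norm_power)
  next
    case False
    \<comment> \<open>Chosen so that \<open>v * (w / u) ^ (2 ^ k + 1) = (c * w)\<^sup>2\<close> for
      \<open>w\<close> in \<open>K\<close>.\<close>
    obtain c where c: "c\<^sup>2 = v / u ^ (2 ^ k + 1)"
      using square_surj by blast
    have "(\<Sum>y\<in>UNIV-{0}. \<chi> (v * y) * W g (u * y powi (- d)))
        = (\<Sum>w\<in>UNIV-{0}. \<chi> (v * (w / u) ^ (2 ^ k + 1)) * W g w)"
    proof (rule sum.reindex_bij_witness[of _ "\<lambda>w. (w / u) ^ (2 ^ k + 1)" "\<lambda>y. u * y powi (- d)"])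
      fix y assume "y \<in> UNIV - {0::'a}"
      then have "(u * y powi (- d) / u) ^ (2 ^ k + 1) = y"
        using powi_norm_inverse(2)[of y] False by simp
      then show "(u * y powi (- d) / u) ^ (2 ^ k + 1) = y"
        "\<chi> (v * (u * y powi (- d) / u) ^ (2 ^ k + 1)) * W g (u * y powi (- d))
          = \<chi> (v * y) * W g (u * y powi (- d))"
        by simp_all
    next
      fix w assume "w \<in> UNIV - {0::'a}"
      then show "u * ((w / u) ^ (2 ^ k + 1)) powi (- d) = w"
        using powi_norm_inverse(1)[of "w / u"] False by simp
    qed (use False in auto)
    also have "\<dots> = 2 ^ m * g (Tr c)"
    proof (rule sum_\<chi>_W[OF sum_g])
      fix w assume w: "w \<in> K" "w \<noteq> 0"
      have "v * (w / u) ^ (2 ^ k + 1) = (c * w)\<^sup>2"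
        by (simp only: power_divide K_power_norm[OF w(1)] power_mult_distrib c) simp
      then show "\<chi> (v * (w / u) ^ (2 ^ k + 1)) = \<chi> (c * w)"
        by (simp only: \<chi>_square)
    qed
    finally show ?thesis
      unfolding eq using False by (simp add: norm_mult norm_power norm_g)
  qed
qed

end

section \<open>From the partitions to trace conditions and root-of-unity weights\<close>

lemma mem_set_A_iff: "x \<noteq> 0 \<Longrightarrow> (x, y) \<in> set_A m k \<gamma> \<longleftrightarrow> Tr (y / x ^ (2 ^ k + 1)) = \<gamma>"
  \<comment> \<open>For nonzero \<open>x\<close> the parameter \<open>s\<close> can only be
    \<open>y / x ^ (2 ^ k + 1)\<close>.\<close>
  by (force simp: set_A_def)

lemma mem_set_B_iff: "y \<noteq> 0 \<Longrightarrow> (x, y) \<in> set_B m k d \<gamma> \<longleftrightarrow> Tr (x / y powi (- d)) = \<gamma>"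
  by (force simp: set_B_def)

context
  fixes \<pi> :: "nat \<Rightarrow> 'a"
  assumes bij: "bij_betw \<pi> {..<2 ^ k} K"
begin

text \<open>The default 0 outside \<open>K\<close> makes the bound \<open>idx_less\<close>
  unconditional.\<close>

definition idx :: "'a \<Rightarrow> nat" where
  "idx z = (if z \<in> K then the_inv_into {..<2 ^ k} \<pi> z else 0)"

lemma idx_less: "idx z < 2 ^ k"
  using the_inv_into_into[of \<pi> "{..<2 ^ k}" z "{..<2 ^ k}"] bij
  by (auto simp: idx_def bij_betw_def)

lemma the_index: "z \<in> K \<Longrightarrow> (THE i. i < 2 ^ k \<and> z = \<pi> i) = idx z"
  using bij by (auto simp: idx_def the_inv_into_def bij_betw_def intro!: arg_cong[of _ _ The])

lemma f_A_eq: "f_A m k \<pi> x y = (if x = 0 then 0 else idx (Tr (y / x ^ (2 ^ k + 1))))"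
  by (simp add: f_A_def mem_set_A_iff the_index)

lemma f_B_eq: "f_B m k d \<pi> x y = (if y = 0 then 0 else idx (Tr (x / y powi (- d))))"
  by (simp add: f_B_def mem_set_B_iff the_index)

text \<open>Reindexing by \<open>\<pi>\<close> gives a full geometric series with ratio
  \<open>\<zeta> ^ a\<close>, which differs from 1 by primitivity.\<close>

lemma sum_root_idx:
  assumes "primitive_root_of_unity (2 ^ k) \<zeta>" "0 < a" "a < 2 ^ k"
  shows "(\<Sum>z\<in>K. \<zeta> ^ (a * idx z)) = 0"
proof -
  have "(\<Sum>z\<in>K. \<zeta> ^ (a * idx z)) = (\<Sum>i<2 ^ k. \<zeta> ^ (a * idx (\<pi> i)))"
    by (rule sum.reindex_bij_betw[OF bij, symmetric])
  also have "\<dots> = (\<Sum>i<2 ^ k. (\<zeta> ^ a) ^ i)"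
  proof (intro sum.cong refl)
    fix i :: nat assume i: "i \<in> {..<2 ^ k}"
    then have "idx (\<pi> i) = i"
      using bij by (auto simp: idx_def bij_betw_def the_inv_into_f_f)
    then show "\<zeta> ^ (a * idx (\<pi> i)) = (\<zeta> ^ a) ^ i"
      by (simp add: power_mult)
  qed
  also have "\<dots> = ((\<zeta> ^ a) ^ (2 ^ k) - 1) / (\<zeta> ^ a - 1)"
    by (rule geometric_sum) (use assms in \<open>auto simp: primitive_root_of_unity_def\<close>)
  also have "(\<zeta> ^ a) ^ (2 ^ k) = (\<zeta> ^ (2 ^ k)) ^ a"
    by (simp only: mult.commute flip: power_mult)
  also have "\<dots> = 1"
    using assms by (simp add: primitive_root_of_unity_def)
  finally show ?thesis
    by simp
qed

lemma norm_root_idx: "primitive_root_of_unity (2 ^ k) \<zeta> \<Longrightarrow> cmod (\<zeta> ^ (a * idx z)) = 1"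
  using power_eq_1_iff[of \<zeta> "2 ^ k"] by (auto simp: primitive_root_of_unity_def norm_power)

lemma Z_bent_f_A:
  fixes d :: int
  assumes d: "[(2 ^ m - 2 ^ k - 2) * d = 1] (mod (2 ^ m - 1))"
  shows "Z_bent m k (f_A m k \<pi>)"
  unfolding Z_bent_def
proof (intro conjI allI impI)
  fix \<zeta> :: complex and a :: nat and u v :: 'a
  assume \<zeta>: "primitive_root_of_unity (2 ^ k) \<zeta>" and a: "0 < a \<and> a < 2 ^ k"
  \<comment> \<open>The value 0 on the exceptional line gives weight \<open>\<zeta> ^ 0 = 1\<close>,
    the default in \<open>norm_walsh_A\<close>.\<close>
  have "\<zeta> ^ (a * f_A m k \<pi> x y) = (if x = 0 then 1 else \<zeta> ^ (a * idx (Tr (y / x ^ (2 ^ k + 1)))))"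
    for x y
    by (simp only: f_A_eq) simp
  then show "cmod (\<Sum>x\<in>UNIV. \<Sum>y\<in>UNIV. \<zeta> ^ (a * f_A m k \<pi> x y) * \<chi> (u * x + v * y)) = 2 ^ m"
    using norm_walsh_A[OF sum_root_idx[OF \<zeta>] norm_root_idx[OF \<zeta>] d, of a u v] a by simp
qed (auto simp: f_A_eq idx_less)

lemma Z_bent_f_B:
  fixes d :: int
  assumes d: "[(2 ^ m - 2 ^ k - 2) * d = 1] (mod (2 ^ m - 1))"
  shows "Z_bent m k (f_B m k d \<pi>)"
  unfolding Z_bent_def
proof (intro conjI allI impI)
  fix \<zeta> :: complex and a :: nat and u v :: 'a
  assume \<zeta>: "primitive_root_of_unity (2 ^ k) \<zeta>" and a: "0 < a \<and> a < 2 ^ k"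
  have "\<zeta> ^ (a * f_B m k d \<pi> x y) = (if y = 0 then 1 else \<zeta> ^ (a * idx (Tr (x / y powi (- d)))))"
    for x y
    by (simp only: f_B_eq) simp
  then show "cmod (\<Sum>x\<in>UNIV. \<Sum>y\<in>UNIV. \<zeta> ^ (a * f_B m k d \<pi> x y) * \<chi> (u * x + v * y)) = 2 ^ m"
    using norm_walsh_B[OF sum_root_idx[OF \<zeta>] norm_root_idx[OF \<zeta>] d, of a u v] a by simp
qed (auto simp: f_B_eq idx_less)

end

end

theorem theorem12:
  fixes m k :: nat and d :: int and \<pi> :: "nat \<Rightarrow> 'a::{field,finite}"
  assumes "m > 0" and "k > 0" and "k dvd m"
    and "CARD('a) = 2 ^ m"
    and "gcd (2 ^ m - 1) (2 ^ k + 1) = (1::int)"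
    and "[(2 ^ m - 2 ^ k - 2) * d = 1] (mod (2 ^ m - 1))"
    and "bij_betw \<pi> {..<2 ^ k} (subfield2 k)"
  shows "Z_bent m k (f_A m k \<pi>) \<and> Z_bent m k (f_B m k d \<pi>)"
proof -
  \<comment> \<open>The bijection with \<open>{..<2 ^ k}\<close> fixes the order of the subfield, as
    the locale demands.\<close>
  have "card (subfield2 k :: 'a set) = 2 ^ k"
    using bij_betw_same_card[OF assms(7)] by simp
  then interpret binary_field_extension m k "TYPE('a)"
    using assms by unfold_locales
  show ?thesis
    using Z_bent_f_A Z_bent_f_B assms by blast
qed

end
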